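(* Let $F$ be a field of characteristic not $2$ and let $A$ be a finite dimensional Novikov algebra over $F$. Then the Baer radical of $A$ coincides with the Andrunakievich radical of $A$, i.e. $B(A)=\mathcal{A}(A)$.
   Context: Algebras over a field are not assumed associative or unital. For elements $x,y,z$ of an algebra, the associator is $(x,y,z)=(xy)z-x(yz)$. An algebra $A$ over a field is a Novikov algebra if $(x,y,z)=(y,x,z)$ and $(xy)z=(xz)y$ for all $x,y,z\in A$. "Ideal" means two-sided ideal; products of subspaces are linear spans of products of elements. Baer radical: for a finite dimensional Novikov algebra $A$, the Baer radical $B(A)$ is the solvable radical of $A$, i.e. the largest solvable ideal of $A$ (it exists, and coincides with the Baer radical of $A$ in the variety of Novikov algebras). An algebra $C$ is solvable if $C^{(n)}=0$ for some $n$, where $C^{(0)}=C$ and $C^{(k+1)}=C^{(k)}C^{(k)}$. Andrunakievich radical: the heart of an algebra is the intersection of all its nonzero ideals. An algebra is subdirectly irreducible if its heart is nonzero; the heart $H$ is idempotent if $H^2=H$. Let $\mathcal{B}$ be the class of all subdirectly irreducible Novikov algebras (over $F$) with idempotent heart. Let $\mathcal{A}$ be the class of all Novikov algebras (over $F$) that admit no surjective homomorphism onto an algebra in $\mathcal{B}$. It is known that $\mathcal{A}$ is a radical class; in particular every Novikov algebra $A$ has a largest ideal belonging (as an algebra) to $\mathcal{A}$. This ideal is denoted $\mathcal{A}(A)$ and is called the Andrunakievich radical of $A$. *)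

theory Defs
  imports "Jordan_Normal_Form.Missing_VectorSpace"
begin

text \<open>
  Algebras over a field are \<^locale>\<open>vectorspace\<close>s whose record additionally interprets the
  \<^const>\<open>mult\<close> field. The \<^const>\<open>one\<close> field of the record is inherited from the
  ring hierarchy and never used: algebras need be neither unital nor associative.
\<close>

locale nonassoc_algebra = vectorspace K A for K and A (structure) +
  assumes mult_closed [simp, intro]:
      "\<lbrakk>x \<in> carrier A; y \<in> carrier A\<rbrakk> \<Longrightarrow> x \<otimes> y \<in> carrier A"
    and mult_add_left:
      "\<lbrakk>x \<in> carrier A; y \<in> carrier A; z \<in> carrier A\<rbrakk>
        \<Longrightarrow> (x \<oplus> y) \<otimes> z = x \<otimes> z \<oplus> y \<otimes> z"
    and mult_add_right:
      "\<lbrakk>x \<in> carrier A; y \<in> carrier A; z \<in> carrier A\<rbrakk>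
        \<Longrightarrow> z \<otimes> (x \<oplus> y) = z \<otimes> x \<oplus> z \<otimes> y"
    and mult_smult_left:
      "\<lbrakk>c \<in> carrier K; x \<in> carrier A; y \<in> carrier A\<rbrakk>
        \<Longrightarrow> (c \<odot> x) \<otimes> y = c \<odot> (x \<otimes> y)"
    and mult_smult_right:
      "\<lbrakk>c \<in> carrier K; x \<in> carrier A; y \<in> carrier A\<rbrakk>
        \<Longrightarrow> x \<otimes> (c \<odot> y) = c \<odot> (x \<otimes> y)"

definition associator :: "('a, 'm) ring_scheme \<Rightarrow> 'a \<Rightarrow> 'a \<Rightarrow> 'a \<Rightarrow> 'a" where
  "associator A x y z = (x \<otimes>\<^bsub>A\<^esub> y) \<otimes>\<^bsub>A\<^esub> z \<ominus>\<^bsub>A\<^esub> x \<otimes>\<^bsub>A\<^esub> (y \<otimes>\<^bsub>A\<^esub> z)"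

locale novikov_algebra = nonassoc_algebra K A for K and A (structure) +
  assumes left_symmetric:
      "\<lbrakk>x \<in> carrier A; y \<in> carrier A; z \<in> carrier A\<rbrakk>
        \<Longrightarrow> associator A x y z = associator A y x z"
    and right_commutative:
      "\<lbrakk>x \<in> carrier A; y \<in> carrier A; z \<in> carrier A\<rbrakk>
        \<Longrightarrow> (x \<otimes> y) \<otimes> z = (x \<otimes> z) \<otimes> y"

locale algebra_ideal = subspace K I A for K and I and A (structure) +
  assumes ideal_left: "\<lbrakk>a \<in> carrier A; x \<in> I\<rbrakk> \<Longrightarrow> a \<otimes> x \<in> I"
    and ideal_right: "\<lbrakk>a \<in> carrier A; x \<in> I\<rbrakk> \<Longrightarrow> x \<otimes> a \<in> I"

definition subspace_prod ::
    "('f, 'k) ring_scheme \<Rightarrow> ('f, 'a, 'm) module_scheme \<Rightarrow> 'a set \<Rightarrow> 'a set \<Rightarrow> 'a set" where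
  "subspace_prod K A U W = module.span K A {x \<otimes>\<^bsub>A\<^esub> y | x y. x \<in> U \<and> y \<in> W}"

fun derived_power ::
    "('f, 'k) ring_scheme \<Rightarrow> ('f, 'a, 'm) module_scheme \<Rightarrow> nat \<Rightarrow> 'a set" where
  "derived_power K C 0 = carrier C"
| "derived_power K C (Suc n) = subspace_prod K C (derived_power K C n) (derived_power K C n)"

definition solvable_algebra ::
    "('f, 'k) ring_scheme \<Rightarrow> ('f, 'a, 'm) module_scheme \<Rightarrow> bool" where
  "solvable_algebra K C \<longleftrightarrow> (\<exists>n. derived_power K C n = {\<zero>\<^bsub>C\<^esub>})"

text \<open>
  As in \<^locale>\<open>subspace\<close>, an ideal \<open>I\<close> of \<open>A\<close> is a set; as an algebra it is
  \<open>A\<lparr>carrier := I\<rparr>\<close>. \<^const>\<open>Greatest\<close> refers to the inclusion order on sets.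
\<close>

definition baer_radical ::
    "('f, 'k) ring_scheme \<Rightarrow> ('f, 'a, 'm) module_scheme \<Rightarrow> 'a set" where
  "baer_radical K A =
    (GREATEST I. algebra_ideal K I A \<and> solvable_algebra K (A\<lparr>carrier := I\<rparr>))"

lemma (in nonassoc_algebra) underlying_module: "module K A"
  by (rule module_axioms)

lemma (in nonassoc_algebra) subspace_prod_mono:
  assumes "U \<subseteq> U'" "W \<subseteq> W'" shows "subspace_prod K A U W \<subseteq> subspace_prod K A U' W'"
  unfolding subspace_prod_def using assms by (intro span_is_monotone) blast

lemma (in nonassoc_algebra) prod_in_subspace_prod:
  assumes "U \<subseteq> carrier A" "W \<subseteq> carrier A" "x \<in> U" "y \<in> W"
  shows "x \<otimes> y \<in> subspace_prod K A U W"
  unfolding subspace_prod_def using assms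
  by (intro subsetD[OF in_own_span]) auto

lemma (in nonassoc_algebra) subspace_prod_submodule:
  assumes "U \<subseteq> carrier A" "W \<subseteq> carrier A"
  shows "submodule K (subspace_prod K A U W) A"
  unfolding subspace_prod_def using assms by (intro span_is_submodule) auto

lemma (in nonassoc_algebra) subspace_prod_least:
  assumes "submodule K N A" "\<And>x y. x \<in> U \<Longrightarrow> y \<in> W \<Longrightarrow> x \<otimes> y \<in> N"
  shows "subspace_prod K A U W \<subseteq> N"
  unfolding subspace_prod_def using assms by (intro span_is_subset) auto

lemma (in nonassoc_algebra) subspace_prod_restrict:
  assumes "submodule K I A" "\<And>x y. x \<in> U \<Longrightarrow> y \<in> W \<Longrightarrow> x \<otimes> y \<in> I"
  shows "subspace_prod K (A\<lparr>carrier := I\<rparr>) U W = subspace_prod K A U W"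
  using span_li_not_depend(1)[of "{x \<otimes> y | x y. x \<in> U \<and> y \<in> W}" I] assms
  unfolding subspace_prod_def by auto

text \<open>
  The derived series of an ideal computed inside the ambient algebra; only used to show that the
  largest solvable ideal exists, so that \<^const>\<open>baer_radical\<close> is well defined.
\<close>

primrec ideal_derived ::
    "('f, 'k) ring_scheme \<Rightarrow> ('f, 'a, 'm) module_scheme \<Rightarrow> 'a set \<Rightarrow> nat \<Rightarrow> 'a set" where
  "ideal_derived K A I 0 = I"
| "ideal_derived K A I (Suc n) = subspace_prod K A (ideal_derived K A I n) (ideal_derived K A I n)"

context nonassoc_algebra
begin

lemma idealD:
  assumes "algebra_ideal K I A"
  shows "submodule K I A" "I \<subseteq> carrier A"
    "\<And>a x. a \<in> carrier A \<Longrightarrow> x \<in> I \<Longrightarrow> a \<otimes> x \<in> I"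
    "\<And>a x. a \<in> carrier A \<Longrightarrow> x \<in> I \<Longrightarrow> x \<otimes> a \<in> I"
proof -
  interpret I: algebra_ideal K I A by fact
  show 1: "submodule K I A" by (rule I.submod)
  then show "I \<subseteq> carrier A" by (simp add: submodule_def)
qed (use algebra_ideal.ideal_left[OF assms] algebra_ideal.ideal_right[OF assms] in auto)

lemma idealI:
  assumes "submodule K I A"
    "\<And>a x. a \<in> carrier A \<Longrightarrow> x \<in> I \<Longrightarrow> a \<otimes> x \<in> I"
    "\<And>a x. a \<in> carrier A \<Longrightarrow> x \<in> I \<Longrightarrow> x \<otimes> a \<in> I"
  shows "algebra_ideal K I A"
  by (intro algebra_ideal.intro subspace.intro algebra_ideal_axioms.intro vectorspace_axioms assms)

lemma ideal_derived_props:
  assumes I: "algebra_ideal K I A"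
  shows "submodule K (ideal_derived K A I n) A \<and> ideal_derived K A I n \<subseteq> I"
proof (induction n)
  case 0 show ?case using idealD(1)[OF I] by simp
next
  case (Suc n)
  note I' = idealD[OF I]
  from Suc I' have c: "ideal_derived K A I n \<subseteq> carrier A" by auto
  have "x \<otimes> y \<in> I" if "x \<in> ideal_derived K A I n" "y \<in> ideal_derived K A I n" for x y
    using that Suc c I'(3) by blast
  then have "subspace_prod K A (ideal_derived K A I n) (ideal_derived K A I n) \<subseteq> I"
    by (intro subspace_prod_least I'(1))
  with subspace_prod_submodule[OF c c] show ?case by simp
qed

lemma derived_power_ideal:
  assumes I: "algebra_ideal K I A"
  shows "derived_power K (A\<lparr>carrier := I\<rparr>) n = ideal_derived K A I n"
proof (induction n)
  case (Suc n)
  note I' = idealD[OF I]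
  have "ideal_derived K A I n \<subseteq> I" using ideal_derived_props[OF I] by blast
  with I'(2,3) have "x \<otimes> y \<in> I"
    if "x \<in> ideal_derived K A I n" "y \<in> ideal_derived K A I n" for x y
    using that by blast
  then have "subspace_prod K (A\<lparr>carrier := I\<rparr>) (ideal_derived K A I n) (ideal_derived K A I n)
      = subspace_prod K A (ideal_derived K A I n) (ideal_derived K A I n)"
    by (intro subspace_prod_restrict I'(1))
  with Suc show ?case by simp
qed simp

lemma ideal_sum:
  assumes I: "algebra_ideal K I A" and J: "algebra_ideal K J A"
  shows "algebra_ideal K (subspace_sum I J) A"
proof (rule idealI)
  note I' = idealD[OF I] and J' = idealD[OF J]
  show "submodule K (subspace_sum I J) A" using I'(1) J'(1) by (rule sum_is_submodule)
  fix a x assume a: "a \<in> carrier A" and "x \<in> subspace_sum I J"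
  then obtain i j where x: "x = i \<oplus> j" "i \<in> I" "j \<in> J" unfolding submodule_sum_def by auto
  have ij: "i \<in> carrier A" "j \<in> carrier A" using x I'(2) J'(2) by auto
  have "a \<otimes> x = a \<otimes> i \<oplus> a \<otimes> j" "x \<otimes> a = i \<otimes> a \<oplus> j \<otimes> a"
    using x(1) a ij by (simp_all add: mult_add_left mult_add_right)
  moreover have "a \<otimes> i \<in> I" "i \<otimes> a \<in> I" "a \<otimes> j \<in> J" "j \<otimes> a \<in> J"
    using a x I' J' by auto
  ultimately show "a \<otimes> x \<in> subspace_sum I J" "x \<otimes> a \<in> subspace_sum I J"
    unfolding submodule_sum_def by auto
qed

lemma ideal_derived_sum:
  assumes I: "algebra_ideal K I A" and J: "algebra_ideal K J A"
  shows "ideal_derived K A (subspace_sum I J) n \<subseteq> subspace_sum (ideal_derived K A I n) J"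
proof (induction n)
  case (Suc n)
  note J' = idealD[OF J]
  let ?D = "ideal_derived K A I n" and ?D' = "ideal_derived K A I (Suc n)"
  have D: "submodule K ?D A" "submodule K ?D' A" "?D \<subseteq> carrier A" "?D' \<subseteq> carrier A"
    using ideal_derived_props[OF I, of n] ideal_derived_props[OF I, of "Suc n"]
      idealD(2)[OF I] by auto
  have "subspace_prod K A (subspace_sum ?D J) (subspace_sum ?D J) \<subseteq> subspace_sum ?D' J"
  proof (rule subspace_prod_least)
    show "submodule K (subspace_sum ?D' J) A" using D(2) J'(1) by (rule sum_is_submodule)
    fix x y assume "x \<in> subspace_sum ?D J" "y \<in> subspace_sum ?D J"
    then obtain d j e k where x: "x = d \<oplus> j" "d \<in> ?D" "j \<in> J" and y: "y = e \<oplus> k" "e \<in> ?D" "k \<in> J"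
      unfolding submodule_sum_def by auto
    have c: "d \<in> carrier A" "e \<in> carrier A" "j \<in> carrier A" "k \<in> carrier A"
      using x y D(3) J'(2) by auto
    have "x \<otimes> y = d \<otimes> e \<oplus> (d \<otimes> k \<oplus> j \<otimes> (e \<oplus> k))"
      using x(1) y(1) c by (simp add: mult_add_left mult_add_right M.a_ac)
    moreover have "d \<otimes> e \<in> ?D'" using prod_in_subspace_prod[OF D(3) D(3)] x y by simp
    moreover have "d \<otimes> k \<oplus> j \<otimes> (e \<oplus> k) \<in> J"
      using J' x y c by (intro submodule.m_closed[OF J'(1)]) auto
    ultimately show "x \<otimes> y \<in> subspace_sum ?D' J" unfolding submodule_sum_def by auto
  qed
  with Suc subspace_prod_mono[OF Suc Suc] show ?case by auto
qed simp

lemma ideal_derived_add: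
  "ideal_derived K A I (m + n) = ideal_derived K A (ideal_derived K A I m) n"
  by (induction n) auto

lemma ideal_derived_mono:
  "I \<subseteq> J \<Longrightarrow> ideal_derived K A I n \<subseteq> ideal_derived K A J n"
  by (induction n) (auto intro: subsetD[OF subspace_prod_mono])

lemma solvable_ideal_sum:
  assumes I: "algebra_ideal K I A" "solvable_algebra K (A\<lparr>carrier := I\<rparr>)"
    and J: "algebra_ideal K J A" "solvable_algebra K (A\<lparr>carrier := J\<rparr>)"
  shows "solvable_algebra K (A\<lparr>carrier := subspace_sum I J\<rparr>)"
proof -
  obtain m n where mn: "ideal_derived K A I m = {\<zero>}" "ideal_derived K A J n = {\<zero>}"
    using I J derived_power_ideal unfolding solvable_algebra_def by auto
  have "subspace_sum {\<zero>} J \<subseteq> J"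
    using idealD(2)[OF J(1)] unfolding submodule_sum_def by (auto simp: subset_iff)
  then have "ideal_derived K A (subspace_sum I J) m \<subseteq> J"
    using ideal_derived_sum[OF I(1) J(1), of m] mn by simp
  then have "ideal_derived K A (subspace_sum I J) (m + n) \<subseteq> {\<zero>}"
    using ideal_derived_mono[of "ideal_derived K A (subspace_sum I J) m" J n]
    by (simp add: ideal_derived_add mn)
  moreover have S: "algebra_ideal K (subspace_sum I J) A" using I(1) J(1) by (rule ideal_sum)
  then have "\<zero> \<in> ideal_derived K A (subspace_sum I J) (m + n)"
    using ideal_derived_props[of "subspace_sum I J" "m + n"] by (simp add: submodule_def)
  ultimately show ?thesis
    unfolding solvable_algebra_def using derived_power_ideal[OF S]
    by (intro exI[of _ "m + n"]) auto
qed

lemma zero_ideal: "algebra_ideal K {\<zero>} A" "solvable_algebra K (A\<lparr>carrier := {\<zero>}\<rparr>)"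
proof -
  have "submodule K {\<zero>} A" using span_is_submodule[of "{}"] by (simp add: span_empty)
  moreover have "a \<otimes> \<zero> = \<zero>" "\<zero> \<otimes> a = \<zero>" if "a \<in> carrier A" for a
    using that mult_smult_left[of "\<zero>\<^bsub>K\<^esub>" a a] mult_smult_right[of "\<zero>\<^bsub>K\<^esub>" a a] by auto
  ultimately show "algebra_ideal K {\<zero>} A" by (intro idealI) auto
  show "solvable_algebra K (A\<lparr>carrier := {\<zero>}\<rparr>)"
    unfolding solvable_algebra_def by (intro exI[of _ 0]) simp
qed

lemma largest_solvable_ideal_exists:
  assumes fd: fin_dim
  obtains R where "algebra_ideal K R A" "solvable_algebra K (A\<lparr>carrier := R\<rparr>)"
    "\<And>I. algebra_ideal K I A \<Longrightarrow> solvable_algebra K (A\<lparr>carrier := I\<rparr>) \<Longrightarrow> I \<subseteq> R"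
proof -
  define S where "S I \<longleftrightarrow> algebra_ideal K I A \<and> solvable_algebra K (A\<lparr>carrier := I\<rparr>)" for I
  define P where "P k \<longleftrightarrow> (\<exists>L R. S R \<and> L \<subseteq> R \<and> lin_indpt L \<and> card L = k)" for k
  have bd: "k \<le> dim" if "P k" for k
    using that li_le_dim(2)[OF fd] idealD(2) unfolding P_def S_def by blast
  have "P 0" unfolding P_def S_def using zero_ideal finite_lin_indpt2[of "{}"]
    by (intro exI[of _ "{}"] exI[of _ "{\<zero>}"]) auto
  then obtain k where k: "P k" "\<And>l. P l \<Longrightarrow> l \<le> k"
    using GreatestI_nat[of P 0 dim] Greatest_le_nat[of P _ dim] bd by blast
  from k(1) obtain L R where R: "S R" "L \<subseteq> R" "lin_indpt L" "card L = k"
    unfolding P_def by blast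
  have I: "I \<subseteq> R" if "S I" for I
  proof -
    let ?T = "subspace_sum R I"
    note R' = idealD[of R] and I' = idealD[of I]
    have sub: "R \<subseteq> ?T" "I \<subseteq> ?T"
      using in_sum[of R I] in_sum[of I R] msum_comm[of R I] R(1) that R'(1) I'(1)
      unfolding S_def by auto
    have T: "S ?T" using ideal_sum solvable_ideal_sum R(1) that unfolding S_def by blast
    have Tc: "?T \<subseteq> carrier A" using T idealD(2) unfolding S_def by blast
    have L: "L \<subseteq> carrier A" using R(2) sub Tc by blast
    have fL: "finite L" using li_le_dim(1)[OF fd L R(3)] .
    have "v \<in> span L" if v: "v \<in> ?T" for v
    proof (rule ccontr)
      assume n: "v \<notin> span L"
      then have vL: "v \<notin> L" using in_own_span[OF L] by blast
      have "lin_indpt (L \<union> {v})"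
        using lin_dep_iff_in_span[of L v] L R(3) n vL v Tc by blast
      then have "P (card (L \<union> {v}))" unfolding P_def using T v R(2) sub by blast
      from k(2)[OF this] show False using fL vL R(4) by simp
    qed
    moreover have "span L \<subseteq> R" using R R'(1) unfolding S_def by (intro span_is_subset) auto
    ultimately show ?thesis using sub by blast
  qed
  show thesis using that[of R] R(1) I unfolding S_def by blast
qed

lemma baer_radical_is_largest:
  assumes fin_dim
  shows "algebra_ideal K (baer_radical K A) A"
    and "solvable_algebra K (A\<lparr>carrier := baer_radical K A\<rparr>)"
    and "\<And>I. algebra_ideal K I A \<Longrightarrow> solvable_algebra K (A\<lparr>carrier := I\<rparr>) \<Longrightarrow> I \<subseteq> baer_radical K A"
proof -
  obtain R where R: "algebra_ideal K R A" "solvable_algebra K (A\<lparr>carrier := R\<rparr>)"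
    "\<And>I. algebra_ideal K I A \<Longrightarrow> solvable_algebra K (A\<lparr>carrier := I\<rparr>) \<Longrightarrow> I \<subseteq> R"
    using largest_solvable_ideal_exists[OF assms] by blast
  have "baer_radical K A = R" unfolding baer_radical_def
    using R by (intro Greatest_equality) auto
  with R show "algebra_ideal K (baer_radical K A) A"
    "solvable_algebra K (A\<lparr>carrier := baer_radical K A\<rparr>)"
    "\<And>I. algebra_ideal K I A \<Longrightarrow> solvable_algebra K (A\<lparr>carrier := I\<rparr>) \<Longrightarrow> I \<subseteq> baer_radical K A"
    by auto
qed

end

text \<open>
  The intersection with \<^term>\<open>carrier A\<close> only matters for the zero algebra, which has no
  nonzero ideals; its heart is zero, so it is not subdirectly irreducible.
\<close>

definition heart :: "('f, 'k) ring_scheme \<Rightarrow> ('f, 'a, 'm) module_scheme \<Rightarrow> 'a set" where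
  "heart K A = carrier A \<inter> \<Inter>{I. algebra_ideal K I A \<and> I \<noteq> {\<zero>\<^bsub>A\<^esub>}}"

definition subdirectly_irreducible ::
    "('f, 'k) ring_scheme \<Rightarrow> ('f, 'a, 'm) module_scheme \<Rightarrow> bool" where
  "subdirectly_irreducible K A \<longleftrightarrow> heart K A \<noteq> {\<zero>\<^bsub>A\<^esub>}"

definition class_B :: "('f, 'k) ring_scheme \<Rightarrow> ('f, 'a, 'm) module_scheme \<Rightarrow> bool" where
  "class_B K C \<longleftrightarrow> novikov_algebra K C \<and> subdirectly_irreducible K C \<and>
    subspace_prod K C (heart K C) (heart K C) = heart K C"

definition algebra_hom ::
    "('f, 'k) ring_scheme \<Rightarrow> ('f, 'a, 'm) module_scheme \<Rightarrow> ('f, 'b, 'n) module_scheme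
      \<Rightarrow> ('a \<Rightarrow> 'b) set" where
  "algebra_hom K A C = {h \<in> module_hom K A C.
    \<forall>x \<in> carrier A. \<forall>y \<in> carrier A. h (x \<otimes>\<^bsub>A\<^esub> y) = h x \<otimes>\<^bsub>C\<^esub> h y}"

text \<open>
  Quantification over all target algebras is expressed over carriers in \<^typ>\<open>'a set\<close>. This is no
  restriction: a homomorphic image of \<open>A\<close> is isomorphic to a quotient of \<open>A\<close>, whose elements
  are cosets, i.e. of type \<^typ>\<open>'a set\<close>; see \<open>class_A_no_hom\<close> below for targets of arbitrary type.
\<close>

definition class_A :: "('f, 'k) ring_scheme \<Rightarrow> ('f, 'a, 'm) module_scheme \<Rightarrow> bool" where
  "class_A K A \<longleftrightarrow> novikov_algebra K A \<and>
    \<not> (\<exists>(C :: ('f, 'a set) module) h.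
        class_B K C \<and> h \<in> algebra_hom K A C \<and> h ` carrier A = carrier C)"

locale algebra_iso = C?: nonassoc_algebra K C + D?: nonassoc_algebra K D
  for K and C (structure) and D (structure) +
  fixes f
  assumes hom: "f \<in> algebra_hom K C D"
    and bij: "bij_betw f (carrier C) (carrier D)"
begin

lemma mod_hom: "mod_hom K C D f"
  using hom C.underlying_module D.underlying_module
  by (auto simp: mod_hom_def mod_hom_axioms_def algebra_hom_def)

lemma hom_simps:
  assumes "x \<in> carrier C" "y \<in> carrier C"
  shows "f x \<in> carrier D" "f (x \<oplus>\<^bsub>C\<^esub> y) = f x \<oplus>\<^bsub>D\<^esub> f y" "f (x \<otimes>\<^bsub>C\<^esub> y) = f x \<otimes>\<^bsub>D\<^esub> f y"
    and "c \<in> carrier K \<Longrightarrow> f (c \<odot>\<^bsub>C\<^esub> x) = c \<odot>\<^bsub>D\<^esub> f x"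
  using hom assms unfolding algebra_hom_def module_hom_def by auto

lemma hom_zero: "f \<zero>\<^bsub>C\<^esub> = \<zero>\<^bsub>D\<^esub>"
  by (rule mod_hom.f0_is_0[OF mod_hom])

lemma image_carrier: "f ` carrier C = carrier D" and inj: "inj_on f (carrier C)"
  using bij by (auto simp: bij_betw_def)

lemma image_submodule:
  assumes "submodule K N C" shows "submodule K (f ` N) D"
proof -
  have N: "N \<subseteq> carrier C" "\<zero>\<^bsub>C\<^esub> \<in> N"
    "\<And>x y. x \<in> N \<Longrightarrow> y \<in> N \<Longrightarrow> x \<oplus>\<^bsub>C\<^esub> y \<in> N"
    "\<And>c x. c \<in> carrier K \<Longrightarrow> x \<in> N \<Longrightarrow> c \<odot>\<^bsub>C\<^esub> x \<in> N"
    using assms by (auto simp: submodule_def)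
  show ?thesis
  proof (rule submodule.intro)
    show "module K D" by (rule D.underlying_module)
    show "f ` N \<subseteq> carrier D" using N(1) image_carrier by blast
    show "\<zero>\<^bsub>D\<^esub> \<in> f ` N" using N(2) hom_zero by (metis image_eqI)
    show "v \<oplus>\<^bsub>D\<^esub> w \<in> f ` N" if "v \<in> f ` N" "w \<in> f ` N" for v w
    proof -
      from that obtain x y where xy: "v = f x" "w = f y" "x \<in> N" "y \<in> N" by blast
      with N(1) have "v \<oplus>\<^bsub>D\<^esub> w = f (x \<oplus>\<^bsub>C\<^esub> y)" using hom_simps(2) by (metis subsetD)
      with N(3) xy show ?thesis by blast
    qed
    show "c \<odot>\<^bsub>D\<^esub> v \<in> f ` N" if "c \<in> carrier K" "v \<in> f ` N" for c v
    proof -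
      from that obtain x where x: "v = f x" "x \<in> N" by blast
      with N(1) that(1) have "c \<odot>\<^bsub>D\<^esub> v = f (c \<odot>\<^bsub>C\<^esub> x)" using hom_simps(4) by (metis subsetD)
      with N(4) that(1) x show ?thesis by blast
    qed
  qed
qed

lemma image_ideal:
  assumes "algebra_ideal K I C" shows "algebra_ideal K (f ` I) D"
proof (rule D.idealI)
  note I = C.idealD[OF assms]
  show "submodule K (f ` I) D" using I(1) by (rule image_submodule)
  fix a x assume "a \<in> carrier D" "x \<in> f ` I"
  then obtain b y where "a = f b" "b \<in> carrier C" "x = f y" "y \<in> I"
    using image_carrier by blast
  moreover from this I(2) have "y \<in> carrier C" by blast
  ultimately show "a \<otimes>\<^bsub>D\<^esub> x \<in> f ` I" "x \<otimes>\<^bsub>D\<^esub> a \<in> f ` I"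
    using I(3,4) by (auto simp flip: hom_simps(3))
qed

lemma image_eq_zero:
  assumes "N \<subseteq> carrier C" shows "f ` N = {\<zero>\<^bsub>D\<^esub>} \<longleftrightarrow> N = {\<zero>\<^bsub>C\<^esub>}"
proof -
  have "f ` N = f ` {\<zero>\<^bsub>C\<^esub>} \<longleftrightarrow> N = {\<zero>\<^bsub>C\<^esub>}"
    using assms by (intro inj_on_image_eq_iff[OF inj]) auto
  then show ?thesis by (simp add: hom_zero)
qed

lemma image_prod:
  assumes "U \<subseteq> carrier C" "W \<subseteq> carrier C"
  shows "subspace_prod K D (f ` U) (f ` W) \<subseteq> f ` subspace_prod K C U W"
proof (rule D.subspace_prod_least)
  show "submodule K (f ` subspace_prod K C U W) D"
    by (intro image_submodule C.subspace_prod_submodule assms)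
  fix x y assume "x \<in> f ` U" "y \<in> f ` W"
  then obtain u w where uw: "x = f u" "y = f w" "u \<in> U" "w \<in> W" by blast
  with assms have "u \<in> carrier C" "w \<in> carrier C" by blast+
  with uw have "x \<otimes>\<^bsub>D\<^esub> y = f (u \<otimes>\<^bsub>C\<^esub> w)" using hom_simps(3) by simp
  with C.prod_in_subspace_prod[OF assms uw(3,4)]
  show "x \<otimes>\<^bsub>D\<^esub> y \<in> f ` subspace_prod K C U W" by blast
qed

lemma image_heart: "heart K D \<subseteq> f ` heart K C"
proof
  fix y assume y: "y \<in> heart K D"
  then obtain x where x: "y = f x" "x \<in> carrier C"
    using image_carrier unfolding heart_def by blast
  have "x \<in> I" if I: "algebra_ideal K I C" "I \<noteq> {\<zero>\<^bsub>C\<^esub>}" for I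
  proof -
    have "y \<in> f ` I"
      using y image_ideal[OF I(1)] image_eq_zero[OF C.idealD(2)[OF I(1)]] I(2)
      unfolding heart_def by blast
    then show ?thesis using x inj C.idealD(2)[OF I(1)] by (meson inj_on_image_mem_iff)
  qed
  with x show "y \<in> f ` heart K C" unfolding heart_def by blast
qed

end

lemma class_B_iso:
  assumes C: "class_B K C" and fg: "algebra_iso K C D f" "algebra_iso K D C g"
    and gf: "\<And>x. x \<in> carrier C \<Longrightarrow> g (f x) = x" "\<And>y. y \<in> carrier D \<Longrightarrow> f (g y) = y"
  shows "class_B K D"
proof -
  interpret f: algebra_iso K C D f by fact
  interpret g: algebra_iso K D C g by fact
  interpret C: novikov_algebra K C using C by (simp add: class_B_def)
  let ?H = "heart K C"
  have H: "?H \<subseteq> carrier C" and fH: "f ` ?H \<subseteq> carrier D"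
    using f.image_carrier unfolding heart_def by auto
  have gfN: "g ` f ` N = N" if "N \<subseteq> carrier C" for N using that gf(1) by force
  have fgN: "f ` g ` N = N" if "N \<subseteq> carrier D" for N using that gf(2) by force
  have "f ` ?H \<subseteq> f ` g ` heart K D" using g.image_heart by (rule image_mono)
  also have "\<dots> = heart K D" by (rule fgN) (simp add: heart_def)
  finally have hD: "heart K D = f ` ?H" using f.image_heart by (intro equalityI)
  have "novikov_algebra K D"
  proof (intro novikov_algebra.intro novikov_algebra_axioms.intro f.D.nonassoc_algebra_axioms)
    fix x y z assume "x \<in> carrier D" "y \<in> carrier D" "z \<in> carrier D"
    then obtain u v w where uvw: "x = f u" "y = f v" "z = f w"
      "u \<in> carrier C" "v \<in> carrier C" "w \<in> carrier C"
      using gf(2)[of x] gf(2)[of y] gf(2)[of z] g.hom_simps(1)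
      by (intro that[of "g x" "g y" "g z"]) auto
    have assoc: "f (associator C a b c) = associator D (f a) (f b) (f c)"
      if "a \<in> carrier C" "b \<in> carrier C" "c \<in> carrier C" for a b c
      using that unfolding associator_def
      by (simp add: mod_hom.f_minus[OF f.mod_hom] f.hom_simps(3))
    show "associator D x y z = associator D y x z"
      using uvw C.left_symmetric[of u v w] by (simp flip: assoc)
    show "x \<otimes>\<^bsub>D\<^esub> y \<otimes>\<^bsub>D\<^esub> z = x \<otimes>\<^bsub>D\<^esub> z \<otimes>\<^bsub>D\<^esub> y"
      using uvw C.right_commutative[of u v w] f.hom_simps(3)[symmetric] by simp
  qed
  moreover have "subdirectly_irreducible K D"
    using C f.image_eq_zero[OF H] hD unfolding class_B_def subdirectly_irreducible_def by simp
  moreover have "subspace_prod K D (f ` ?H) (f ` ?H) = f ` ?H"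
  proof
    have HH: "subspace_prod K C ?H ?H = ?H" using C by (simp add: class_B_def)
    show "subspace_prod K D (f ` ?H) (f ` ?H) \<subseteq> f ` ?H" using f.image_prod[OF H H] HH by simp
    have "?H \<subseteq> g ` subspace_prod K D (f ` ?H) (f ` ?H)"
      using g.image_prod[OF fH fH] HH by (simp add: gfN[OF H])
    then have "f ` ?H \<subseteq> f ` g ` subspace_prod K D (f ` ?H) (f ` ?H)" by (rule image_mono)
    also have "\<dots> = subspace_prod K D (f ` ?H) (f ` ?H)"
      using f.D.subspace_prod_submodule[OF fH fH] by (intro fgN) (simp add: submodule_def)
    finally show "f ` ?H \<subseteq> subspace_prod K D (f ` ?H) (f ` ?H)" .
  qed
  ultimately show ?thesis using hD by (simp add: class_B_def)
qed

lemma class_A_no_hom: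
  fixes A :: "('f, 'a, 'm) module_scheme" and C :: "('f, 'c, 'n) module_scheme"
  assumes A: "class_A K A" and C: "class_B K C" and h: "h \<in> algebra_hom K A C"
  shows "h ` carrier A \<noteq> carrier C"
proof
  assume surj: "h ` carrier A = carrier C"
  interpret C: novikov_algebra K C using C by (simp add: class_B_def)
  define f where "f c = {x \<in> carrier A. h x = c}" for c
  define g where "g u = (THE c. c \<in> carrier C \<and> f c = u)" for u
  have inj: "c = d" if "c \<in> carrier C" "d \<in> carrier C" "f c = f d" for c d
  proof -
    from that(1) surj obtain x where x: "x \<in> carrier A" "c = h x" by blast
    then have "x \<in> f c" by (simp add: f_def)
    then have "x \<in> f d" using that(3) by simp
    then show ?thesis using x by (simp add: f_def)
  qed
  have gf: "g (f c) = c" if "c \<in> carrier C" for c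
    unfolding g_def using that inj by (intro the_equality) auto
  define D :: "('f, 'a set) module" where
    "D = \<lparr>carrier = f ` carrier C, mult = (\<lambda>u v. f (g u \<otimes>\<^bsub>C\<^esub> g v)), one = {},
      zero = f \<zero>\<^bsub>C\<^esub>, add = (\<lambda>u v. f (g u \<oplus>\<^bsub>C\<^esub> g v)), smult = (\<lambda>c u. f (c \<odot>\<^bsub>C\<^esub> g u))\<rparr>"
  have cD: "carrier D = f ` carrier C" by (simp add: D_def)
  have D: "\<zero>\<^bsub>D\<^esub> = f \<zero>\<^bsub>C\<^esub>"
    "\<And>x y. x \<in> carrier C \<Longrightarrow> y \<in> carrier C \<Longrightarrow> f x \<oplus>\<^bsub>D\<^esub> f y = f (x \<oplus>\<^bsub>C\<^esub> y)"
    "\<And>x y. x \<in> carrier C \<Longrightarrow> y \<in> carrier C \<Longrightarrow> f x \<otimes>\<^bsub>D\<^esub> f y = f (x \<otimes>\<^bsub>C\<^esub> y)"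
    "\<And>c x. x \<in> carrier C \<Longrightarrow> c \<odot>\<^bsub>D\<^esub> f x = f (c \<odot>\<^bsub>C\<^esub> x)"
    by (simp_all add: D_def gf)
  have comm: "f (x \<oplus>\<^bsub>C\<^esub> y) = f (y \<oplus>\<^bsub>C\<^esub> x)" if "x \<in> carrier C" "y \<in> carrier C" for x y
    using C.M.a_comm[OF that] by simp
  have "module K D"
  proof (rule module_criteria)
    show "cring K" by (rule C.cring_axioms)
    show "\<forall>v\<in>carrier D. \<exists>w\<in>carrier D. v \<oplus>\<^bsub>D\<^esub> w = \<zero>\<^bsub>D\<^esub>"
    proof
      fix v assume "v \<in> carrier D"
      then obtain x where x: "v = f x" "x \<in> carrier C" by (auto simp: cD)
      then have "v \<oplus>\<^bsub>D\<^esub> f (\<ominus>\<^bsub>C\<^esub> x) = \<zero>\<^bsub>D\<^esub>" by (simp add: D C.M.r_neg)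
      then show "\<exists>w\<in>carrier D. v \<oplus>\<^bsub>D\<^esub> w = \<zero>\<^bsub>D\<^esub>" using x by (auto simp: cD)
    qed
    show "\<forall>v w. v \<in> carrier D \<and> w \<in> carrier D \<longrightarrow> v \<oplus>\<^bsub>D\<^esub> w = w \<oplus>\<^bsub>D\<^esub> v"
      using comm by (auto simp: cD D(2))
  qed (auto simp: cD D C.M.a_assoc C.smult_l_distr C.smult_r_distr C.smult_assoc1)
  then have vs: "vectorspace K D" by (intro vectorspace.intro C.field_axioms)
  have nD: "nonassoc_algebra K D"
    by (intro nonassoc_algebra.intro nonassoc_algebra_axioms.intro vs)
      (auto simp: cD D C.mult_add_left C.mult_add_right C.mult_smult_left C.mult_smult_right)
  have gD: "g u \<in> carrier C" "f (g u) = u" if "u \<in> carrier D" for u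
    using that gf by (auto simp: cD)
  have fi: "algebra_iso K C D f"
    by (intro algebra_iso.intro algebra_iso_axioms.intro nD C.nonassoc_algebra_axioms)
      (auto simp: algebra_hom_def module_hom_def cD D bij_betw_def inj_on_def intro: inj)
  have gi: "algebra_iso K D C g"
  proof (intro algebra_iso.intro algebra_iso_axioms.intro nD C.nonassoc_algebra_axioms)
    show "g \<in> algebra_hom K D C"
      by (auto simp: algebra_hom_def module_hom_def cD D gf)
    show "bij_betw g (carrier D) (carrier C)"
      by (rule bij_betw_byWitness[where f' = f]) (auto simp: cD gf)
  qed
  have B: "class_B K D" using class_B_iso[OF C fi gi gf gD(2)] .
  have hA: "h x \<in> carrier C" if "x \<in> carrier A" for x using surj that by blast
  interpret A: novikov_algebra K A using A by (simp add: class_A_def)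
  have "(\<lambda>x. f (h x)) \<in> algebra_hom K A D"
    using h hA by (auto simp: algebra_hom_def module_hom_def cD D)
  moreover have "(\<lambda>x. f (h x)) ` carrier A = carrier D"
    using surj by (simp add: cD flip: image_image)
  ultimately show False using A B unfolding class_A_def by blast
qed

definition andrunakievich_radical ::
    "('f, 'k) ring_scheme \<Rightarrow> ('f, 'a, 'm) module_scheme \<Rightarrow> 'a set" where
  "andrunakievich_radical K A =
    (GREATEST I. algebra_ideal K I A \<and> class_A K (A\<lparr>carrier := I\<rparr>))"

end

theory Submission
  imports Defs "HOL-Algebra.AbelCoset"
begin

text \<open>
  In a Novikov algebra the product of two ideals is again an ideal, so the derived series of a
  finite dimensional algebra \<open>A\<close> consists of ideals and stabilizes at an ideal \<open>D\<close> with
  \<open>D\<^sup>2 = D\<close>. If \<open>A\<close> is not solvable, then \<open>D\<close> is nonzero; choose an ideal \<open>M\<close> maximal among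
  those not containing \<open>D\<close>. Every ideal properly containing \<open>M\<close> contains \<open>D\<close>, hence
  \<open>(D + M) / M\<close> is the heart of \<open>A / M\<close>, and it is idempotent. So an algebra in the
  Andrunakievich class is solvable. Conversely an idempotent heart lies in every term of the
  derived series, so no solvable algebra maps onto an algebra in \<^const>\<open>class_B\<close>.
\<close>

section \<open>Subspaces of finite dimensional spaces\<close>

lemma (in vectorspace) lin_indpt_insert:
  assumes "L \<subseteq> carrier V" "lin_indpt L" "v \<in> carrier V" "v \<notin> span L"
  shows "v \<notin> L" "lin_indpt (insert v L)"
proof -
  show vL: "v \<notin> L" using in_own_span[OF assms(1)] assms(4) by (rule contra_subsetD)
  show "lin_indpt (insert v L)"
    using lin_dep_iff_in_span[OF assms(1-3) vL] assms(4) by simp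
qed

lemma (in vectorspace) submodule_vectorspace:
  assumes "submodule K N V" shows "vectorspace K (vs N)"
  using assms by (intro subspace_is_vs) (simp add: subspace_def vectorspace_axioms)

text \<open>Independent subsets of \<open>N\<close> have at most \<open>dim\<close> elements, so one
  of largest size exists. It spans \<open>N\<close>, because a vector outside its span could be
  added to it.\<close>

lemma (in vectorspace) submodule_fin_dim:
  assumes fd: fin_dim and N: "submodule K N V"
  shows "vectorspace.fin_dim K (vs N)"
proof -
  interpret N: vectorspace K "vs N" using N by (rule submodule_vectorspace)
  have NV: "N \<subseteq> carrier V" using N by (simp add: submodule_def)
  define P where "P k \<longleftrightarrow> (\<exists>L \<subseteq> N. lin_indpt L \<and> card L = k)" for k
  have bd: "k \<le> dim" if "P k" for k
  proof -
    from that obtain L where L: "L \<subseteq> N" "lin_indpt L" "card L = k" unfolding P_def by blast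
    from L(1) NV have "L \<subseteq> carrier V" by (rule subset_trans)
    from li_le_dim(2)[OF fd this L(2)] L(3) show ?thesis by simp
  qed
  have "P 0" unfolding P_def using finite_lin_indpt2[of "{}"] by (intro exI[of _ "{}"]) auto
  then obtain k where k: "P k" "\<And>l. P l \<Longrightarrow> l \<le> k"
    using GreatestI_nat[of P 0 dim] Greatest_le_nat[of P _ dim] bd by blast
  from k(1) obtain L where L: "L \<subseteq> N" "lin_indpt L" "card L = k" unfolding P_def by blast
  have LV: "L \<subseteq> carrier V" and fL: "finite L" using li_le_dim(1)[OF fd _ L(2)] L(1) NV by auto
  have "v \<in> span L" if v: "v \<in> N" for v
  proof (rule ccontr)
    assume n: "v \<notin> span L"
    have vV: "v \<in> carrier V" using v NV by (rule rev_subsetD)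
    note vL = lin_indpt_insert[OF LV L(2) vV n]
    have "insert v L \<subseteq> N" using v L(1) by simp
    then have "P (card (insert v L))" unfolding P_def using vL(2) by blast
    from k(2)[OF this] show False using card_insert_disjoint[OF fL vL(1)] L(3) by simp
  qed
  moreover have "span L \<subseteq> N" using L(1) N by (intro span_is_subset)
  \<comment> \<open>So far span and independence were taken in the ambient space;
    \<open>span_li_not_depend\<close> carries the span over to \<open>vs N\<close>.\<close>
  ultimately have "N.span L = N" using span_li_not_depend(1)[OF L(1) N] by blast
  then show ?thesis unfolding N.fin_dim_def using fL L(1) by (intro exI[of _ L]) simp
qed

text \<open>A basis of \<open>N\<close> together with one vector of \<open>N'\<close> outside
  \<open>N\<close> is still independent, which leaves room for at least one more dimension in
  \<open>N'\<close>.\<close>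

lemma (in vectorspace) submodule_dim_less:
  assumes fd: fin_dim and N: "submodule K N V" and N': "submodule K N' V" and less: "N \<subset> N'"
  shows "vectorspace.dim K (vs N) < vectorspace.dim K (vs N')"
proof -
  interpret N: vectorspace K "vs N" using N by (rule submodule_vectorspace)
  interpret N': vectorspace K "vs N'" using N' by (rule submodule_vectorspace)
  have NV: "N \<subseteq> carrier V" "N' \<subseteq> carrier V" using N N' by (simp_all add: submodule_def)
  obtain L where L: "finite L" "N.basis L"
    using N.finite_basis_exists[OF submodule_fin_dim[OF fd N]] by blast
  then have LN: "L \<subseteq> N" and "N.lin_indpt L" "N.span L = N" by (auto simp: N.basis_def)
  with N have li: "lin_indpt L" and sp: "span L = N"
    using span_li_not_depend[OF LN N] by auto
  obtain v where v: "v \<in> N'" "v \<notin> N" using less by blast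
  have LV: "L \<subseteq> carrier V" using LN NV(1) by (rule subset_trans)
  have vV: "v \<in> carrier V" using v(1) NV(2) by (rule rev_subsetD)
  note vL = lin_indpt_insert[OF LV li vV v(2)[folded sp]]
  have S: "insert v L \<subseteq> N'" using LN less v by blast
  then have "N'.lin_indpt (insert v L)" using span_li_not_depend(2)[OF S N'] vL(2) by simp
  from N'.li_le_dim(2)[OF submodule_fin_dim[OF fd N'] _ this] S
  have "card (insert v L) \<le> N'.dim" by (simp only: carrier_vs_is_self)
  then show ?thesis
    unfolding N.dim_basis[OF L] card_insert_disjoint[OF L(1) vL(1)] by (rule Suc_le_lessD)
qed

text \<open>At an index of minimal dimension the next term cannot be strictly smaller. One such
  equality suffices later: for derived powers it already makes the term idempotent.\<close>

lemma (in vectorspace) submodule_chain_stationary: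
  assumes fd: fin_dim and N: "\<And>n. submodule K (N n) V" and dec: "\<And>n :: nat. N (Suc n) \<subseteq> N n"
  obtains n where "N (Suc n) = N n"
proof -
  let ?d = "\<lambda>n. vectorspace.dim K (vs (N n))"
  obtain n where "\<And>m. ?d n \<le> ?d m" using ex_has_least_nat[of "\<lambda>_. True" 0 ?d] by auto
  then have "\<not> N (Suc n) \<subset> N n"
    using submodule_dim_less[OF fd N N, of "Suc n" n] by (meson leD)
  with dec[of n] show thesis by (intro that) blast
qed

text \<open>Dimensions of subspaces are bounded, so a subspace of largest dimension among those
  satisfying \<open>P\<close> is maximal for inclusion. This replaces Zorn's lemma in the choice of
  the ideal \<open>M\<close>.\<close>

lemma (in vectorspace) maximal_submodule_exists:
  assumes fd: fin_dim and P: "P N\<^sub>0" and sub: "\<And>N. P N \<Longrightarrow> submodule K N V"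
  obtains N where "P N" "\<And>N'. P N' \<Longrightarrow> N \<subseteq> N' \<Longrightarrow> N' = N"
proof -
  let ?d = "\<lambda>N. vectorspace.dim K (vs N)"
  have V: "submodule K (carrier V) V" by (simp add: submodule_def module_axioms)
  \<comment> \<open>\<open>ex_has_greatest_nat\<close> wants a strict bound, and \<open>N\<close>
    may be the whole space; hence the \<open>Suc\<close>.\<close>
  have "?d N < Suc (?d (carrier V))" if "P N" for N
  proof (cases "N = carrier V")
    case False
    then have "N \<subset> carrier V" using sub[OF that] by (auto simp: submodule_def)
    from submodule_dim_less[OF fd sub[OF that] V this] show ?thesis by (rule less_SucI)
  qed simp
  then obtain N where N: "P N" "\<And>N'. P N' \<Longrightarrow> ?d N' \<le> ?d N"
    using ex_has_greatest_nat[of P N\<^sub>0 ?d "Suc (?d (carrier V))"] P by blast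
  show thesis
  proof (rule that[OF N(1)])
    fix N' assume N': "P N'" "N \<subseteq> N'"
    then have "\<not> N \<subset> N'"
      using submodule_dim_less[OF fd sub sub, of N N'] N by (meson leD)
    with N'(2) show "N' = N" by blast
  qed
qed

section \<open>Ideals of Novikov algebras\<close>

context nonassoc_algebra
begin

lemma submodule_minus:
  assumes "submodule K N A" "x \<in> N" shows "\<ominus> x \<in> N"
  using assms smult_minus_1[of x] unfolding submodule_def
  by (metis R.add.inv_closed one_closed subsetD)

lemma carrier_ideal: "algebra_ideal K (carrier A) A"
  by (intro idealI) (auto simp: submodule_def module_axioms)

text \<open>Subtraction refers to the additive inverse of the structure at hand, which depends on
  its carrier. The lemma lets associators in an ideal be computed in \<open>A\<close>.\<close>

lemma submodule_a_minus:
  assumes N: "submodule K N A" and "x \<in> N" "y \<in> N"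
  shows "x \<ominus>\<^bsub>A\<lparr>carrier := N\<rparr>\<^esub> y = x \<ominus> y"
proof -
  interpret N: module K "A\<lparr>carrier := N\<rparr>" using N by (rule submodule_is_module)
  have "\<ominus> y \<in> N" "y \<in> carrier A" using submodule_minus assms by (auto simp: submodule_def)
  then have "\<ominus>\<^bsub>A\<lparr>carrier := N\<rparr>\<^esub> y = \<ominus> y"
    using N.M.minus_equality[of "\<ominus> y" y] assms M.l_neg by simp
  then show ?thesis by (simp add: a_minus_def)
qed

lemma ideal_nonassoc_algebra:
  assumes I: "algebra_ideal K I A" shows "nonassoc_algebra K (A\<lparr>carrier := I\<rparr>)"
proof -
  note I = idealD[OF I]
  have c: "x \<in> carrier A" if "x \<in> I" for x using that I(2) by blast
  show ?thesis
    by (intro nonassoc_algebra.intro submodule_vectorspace I(1) nonassoc_algebra_axioms.intro)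
      (use I(3) in \<open>simp_all add: c mult_add_left mult_add_right mult_smult_left mult_smult_right\<close>)
qed

end

context novikov_algebra
begin

text \<open>Left symmetry solved for \<open>a \<otimes> (x \<otimes> y)\<close>. If \<open>x\<close>
  and \<open>y\<close> lie in ideals \<open>I\<close> and \<open>J\<close>, each term on the right
  is, up to sign, an element of \<open>I\<close> times an element of \<open>J\<close>.\<close>

lemma left_symmetric_mult:
  assumes "a \<in> carrier A" "x \<in> carrier A" "y \<in> carrier A"
  shows "a \<otimes> (x \<otimes> y) = (a \<otimes> x) \<otimes> y \<oplus> (\<ominus> ((x \<otimes> a) \<otimes> y) \<oplus> x \<otimes> (a \<otimes> y))"
proof -
  have "(a \<otimes> x) \<otimes> y \<oplus> \<ominus> (a \<otimes> (x \<otimes> y)) = (x \<otimes> a) \<otimes> y \<oplus> \<ominus> (x \<otimes> (a \<otimes> y))"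
    using left_symmetric[OF assms] by (simp add: associator_def a_minus_def)
  moreover have "r = p \<oplus> (\<ominus> q \<oplus> s)" if "p \<oplus> \<ominus> r = q \<oplus> \<ominus> s"
    "p \<in> carrier A" "q \<in> carrier A" "r \<in> carrier A" "s \<in> carrier A" for p q r s
  proof -
    have "r = (p \<oplus> \<ominus> (p \<oplus> \<ominus> r))" using that(2,4) by (simp add: M.minus_add M.r_neg2)
    also have "\<dots> = p \<oplus> \<ominus> (q \<oplus> \<ominus> s)" by (simp only: that(1))
    also have "\<dots> = p \<oplus> (\<ominus> q \<oplus> s)" using that(3,5) by (simp add: M.minus_add)
    finally show ?thesis .
  qed
  ultimately show ?thesis using assms by simp
qed

text \<open>Both Novikov identities enter here: left symmetry absorbs a factor on the left, and
  right commutativity turns \<open>(x \<otimes> y) \<otimes> a\<close> into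
  \<open>(x \<otimes> a) \<otimes> y\<close>.\<close>

lemma ideal_prod:
  assumes I: "algebra_ideal K I A" and J: "algebra_ideal K J A"
  shows "algebra_ideal K (subspace_prod K A I J) A"
proof (rule idealI)
  note I = idealD[OF I] and J = idealD[OF J]
  let ?P = "subspace_prod K A I J"
  show P: "submodule K ?P A" using I(2) J(2) by (rule subspace_prod_submodule)
  have mem: "x \<otimes> y \<in> ?P" if "x \<in> I" "y \<in> J" for x y
    using prod_in_subspace_prod[OF I(2) J(2) that] .
  have add: "x \<oplus> y \<in> ?P" if "x \<in> ?P" "y \<in> ?P" for x y
    using P that by (simp add: submodule_def)
  \<comment> \<open>Elements that \<open>a\<close> multiplies into \<open>?P\<close> from both sides
    form a subspace, so checking the generating products is enough.\<close>
  have sub: "submodule K {x \<in> carrier A. a \<otimes> x \<in> ?P \<and> x \<otimes> a \<in> ?P} A" if "a \<in> carrier A" for a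
  proof -
    have "a \<otimes> \<zero> = \<zero>" "\<zero> \<otimes> a = \<zero>"
      using that mult_smult_left[of "\<zero>\<^bsub>K\<^esub>" a a] mult_smult_right[of "\<zero>\<^bsub>K\<^esub>" a a] by auto
    then show ?thesis using P that
      by (auto simp: submodule_def mult_add_left mult_add_right mult_smult_left mult_smult_right)
  qed
  fix a assume a: "a \<in> carrier A"
  have "?P \<subseteq> {x \<in> carrier A. a \<otimes> x \<in> ?P \<and> x \<otimes> a \<in> ?P}"
  proof (rule subspace_prod_least[OF sub[OF a]])
    fix x y assume xy: "x \<in> I" "y \<in> J"
    then have c: "x \<in> carrier A" "y \<in> carrier A" using I(2) J(2) by auto
    have "a \<otimes> (x \<otimes> y) \<in> ?P"
      unfolding left_symmetric_mult[OF a c]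
      by (intro add submodule_minus[OF P] mem xy I(3,4) J(3) a)
    moreover have "(x \<otimes> y) \<otimes> a \<in> ?P"
      using right_commutative[OF c a] mem[OF I(4)[OF a xy(1)] xy(2)] by simp
    ultimately show "x \<otimes> y \<in> {x \<in> carrier A. a \<otimes> x \<in> ?P \<and> x \<otimes> a \<in> ?P}" using c by simp
  qed
  then show "a \<otimes> x \<in> ?P" "x \<otimes> a \<in> ?P" if "x \<in> ?P" for x using that by auto
qed

lemma derived_power_is_ideal: "algebra_ideal K (derived_power K A n) A"
  by (induction n) (simp_all add: carrier_ideal ideal_prod)

lemma ideal_novikov_algebra:
  assumes I: "algebra_ideal K I A" shows "novikov_algebra K (A\<lparr>carrier := I\<rparr>)"
proof -
  note I' = idealD[OF I]
  have c: "x \<in> carrier A" if "x \<in> I" for x using that I'(2) by blast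
  have "associator (A\<lparr>carrier := I\<rparr>) x y z = associator A x y z"
    if "x \<in> I" "y \<in> I" "z \<in> I" for x y z
    using that I'(3) c by (simp add: associator_def submodule_a_minus[OF I'(1)])
  then show ?thesis
    by (intro novikov_algebra.intro novikov_algebra_axioms.intro ideal_nonassoc_algebra I)
      (simp_all add: c left_symmetric right_commutative)
qed

end

section \<open>Surjective homomorphisms and quotients\<close>

text \<open>The surjective counterpart of \<open>algebra_iso\<close>. It serves both the projection
  onto a quotient and a map from a solvable algebra onto a member of \<open>class_B\<close>.\<close>

locale algebra_epi = C?: nonassoc_algebra K C + D?: nonassoc_algebra K D
  for K and C (structure) and D (structure) +
  fixes f
  assumes hom: "f \<in> algebra_hom K C D"
    and surj: "f ` carrier C = carrier D"
begin

sublocale H: mod_hom K C D f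
  using hom by unfold_locales (simp add: algebra_hom_def)

lemma f_mult: "x \<in> carrier C \<Longrightarrow> y \<in> carrier C \<Longrightarrow> f (x \<otimes>\<^bsub>C\<^esub> y) = f x \<otimes>\<^bsub>D\<^esub> f y"
  using hom by (simp add: algebra_hom_def)

lemma image_submodule:
  assumes "submodule K N C" shows "submodule K (f ` N) D"
proof -
  have N: "N \<subseteq> carrier C" "\<zero>\<^bsub>C\<^esub> \<in> N"
    "\<And>x y. x \<in> N \<Longrightarrow> y \<in> N \<Longrightarrow> x \<oplus>\<^bsub>C\<^esub> y \<in> N"
    "\<And>c x. c \<in> carrier K \<Longrightarrow> x \<in> N \<Longrightarrow> c \<odot>\<^bsub>C\<^esub> x \<in> N"
    using assms by (auto simp: submodule_def)
  then have c: "x \<in> carrier C" if "x \<in> N" for x using that by blast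
  show ?thesis
  proof (rule submodule.intro)
    show "\<zero>\<^bsub>D\<^esub> \<in> f ` N" using N(2) H.f0_is_0 by (metis image_eqI)
  qed (use N c surj D.underlying_module in \<open>auto simp flip: H.f_add H.f_smult\<close>)
qed

lemma image_ideal:
  assumes "algebra_ideal K I C" shows "algebra_ideal K (f ` I) D"
proof (rule D.idealI)
  note I = C.idealD[OF assms]
  show "submodule K (f ` I) D" using I(1) by (rule image_submodule)
  fix a x assume "a \<in> carrier D" "x \<in> f ` I"
  then obtain b y where "a = f b" "b \<in> carrier C" "x = f y" "y \<in> I" using surj by blast
  moreover from this I(2) have "y \<in> carrier C" by blast
  ultimately show "a \<otimes>\<^bsub>D\<^esub> x \<in> f ` I" "x \<otimes>\<^bsub>D\<^esub> a \<in> f ` I"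
    using I(3,4) by (auto simp flip: f_mult)
qed

lemma preimage_submodule:
  assumes "submodule K N D" shows "submodule K {x \<in> carrier C. f x \<in> N} C"
  using assms C.underlying_module by (simp add: submodule_def)

lemma preimage_ideal:
  assumes "algebra_ideal K J D" shows "algebra_ideal K {x \<in> carrier C. f x \<in> J} C"
  using D.idealD[OF assms] preimage_submodule
  by (intro C.idealI) (auto simp: f_mult)

text \<open>Each inclusion follows from minimality of the span, once against the image of a subspace
  and once against the preimage of one.\<close>

lemma image_prod:
  assumes U: "U \<subseteq> carrier C" and W: "W \<subseteq> carrier C"
  shows "subspace_prod K D (f ` U) (f ` W) = f ` subspace_prod K C U W"
proof
  show "subspace_prod K D (f ` U) (f ` W) \<subseteq> f ` subspace_prod K C U W"
  proof (rule D.subspace_prod_least)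
    show "submodule K (f ` subspace_prod K C U W) D"
      by (intro image_submodule C.subspace_prod_submodule assms)
    fix x y assume "x \<in> f ` U" "y \<in> f ` W"
    then obtain u w where uw: "x = f u" "y = f w" "u \<in> U" "w \<in> W" by blast
    with assms have "x \<otimes>\<^bsub>D\<^esub> y = f (u \<otimes>\<^bsub>C\<^esub> w)" using f_mult by (metis subsetD)
    with C.prod_in_subspace_prod[OF assms uw(3,4)]
    show "x \<otimes>\<^bsub>D\<^esub> y \<in> f ` subspace_prod K C U W" by blast
  qed
  have fU: "f ` U \<subseteq> carrier D" and fW: "f ` W \<subseteq> carrier D" using assms surj by blast+
  have "subspace_prod K C U W \<subseteq> {x \<in> carrier C. f x \<in> subspace_prod K D (f ` U) (f ` W)}"
  proof (rule C.subspace_prod_least)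
    show "submodule K {x \<in> carrier C. f x \<in> subspace_prod K D (f ` U) (f ` W)} C"
      by (intro preimage_submodule D.subspace_prod_submodule fU fW)
    fix x y assume xy: "x \<in> U" "y \<in> W"
    with assms have "x \<in> carrier C" "y \<in> carrier C" by blast+
    with xy show "x \<otimes>\<^bsub>C\<^esub> y \<in> {x \<in> carrier C. f x \<in> subspace_prod K D (f ` U) (f ` W)}"
      using D.prod_in_subspace_prod[OF fU fW] by (simp add: f_mult)
  qed
  then show "f ` subspace_prod K C U W \<subseteq> subspace_prod K D (f ` U) (f ` W)" by blast
qed

lemma derived_power_carrier: "derived_power K C n \<subseteq> carrier C"
  by (induction n) (use C.subspace_prod_submodule in \<open>simp_all add: submodule_def\<close>)

lemma image_derived_power: "f ` derived_power K C n = derived_power K D n"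
  by (induction n) (simp_all add: surj derived_power_carrier flip: image_prod)

lemma image_novikov_algebra:
  assumes "novikov_algebra K C" shows "novikov_algebra K D"
proof -
  interpret N: novikov_algebra K C by fact
  have assoc: "associator D (f a) (f b) (f c) = f (associator C a b c)"
    if "a \<in> carrier C" "b \<in> carrier C" "c \<in> carrier C" for a b c
    using that unfolding associator_def by (simp add: f_mult)
  show ?thesis
  proof (intro novikov_algebra.intro novikov_algebra_axioms.intro D.nonassoc_algebra_axioms)
    fix x y z assume "x \<in> carrier D" "y \<in> carrier D" "z \<in> carrier D"
    then obtain u v w where uvw: "x = f u" "y = f v" "z = f w"
      "u \<in> carrier C" "v \<in> carrier C" "w \<in> carrier C"
      unfolding surj[symmetric] by blast
    show "associator D x y z = associator D y x z"
      using uvw N.left_symmetric[of u v w] by (simp add: assoc)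
    show "x \<otimes>\<^bsub>D\<^esub> y \<otimes>\<^bsub>D\<^esub> z = x \<otimes>\<^bsub>D\<^esub> z \<otimes>\<^bsub>D\<^esub> y"
      using uvw N.right_commutative[of u v w] by (simp flip: f_mult)
  qed
qed

text \<open>The image of \<open>I\<close> is the heart of \<open>D\<close>: a nonzero ideal of
  \<open>D\<close> pulls back to an ideal strictly above the kernel, which contains \<open>I\<close>
  by \<open>max\<close>. Idempotence passes to the image by \<open>image_prod\<close>.\<close>

lemma class_B_image:
  assumes novikov: "novikov_algebra K C" and I: "algebra_ideal K I C"
    and idem: "subspace_prod K C I I = I"
    and ker: "\<not> I \<subseteq> {x \<in> carrier C. f x = \<zero>\<^bsub>D\<^esub>}"
    and max: "\<And>J. algebra_ideal K J C \<Longrightarrow> {x \<in> carrier C. f x = \<zero>\<^bsub>D\<^esub>} \<subset> J \<Longrightarrow> I \<subseteq> J"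
  shows "class_B K D"
proof -
  note I' = C.idealD[OF I]
  have nz: "f ` I \<noteq> {\<zero>\<^bsub>D\<^esub>}" using ker I'(2) by blast
  have "f ` I \<subseteq> J" if J: "algebra_ideal K J D" "J \<noteq> {\<zero>\<^bsub>D\<^esub>}" for J
  proof -
    have z: "\<zero>\<^bsub>D\<^esub> \<in> J" using D.idealD(1)[OF J(1)] by (simp add: submodule_def)
    then obtain y where y: "y \<in> J" "y \<noteq> \<zero>\<^bsub>D\<^esub>" using J(2) by blast
    then obtain x where "x \<in> carrier C" "y = f x" using D.idealD(2)[OF J(1)] surj by blast
    with y z have "{x \<in> carrier C. f x = \<zero>\<^bsub>D\<^esub>} \<subset> {x \<in> carrier C. f x \<in> J}"
      by (intro psubsetI) auto
    then show ?thesis using max[OF preimage_ideal[OF J(1)]] by blast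
  qed
  moreover have "algebra_ideal K (f ` I) D" using I by (rule image_ideal)
  ultimately have "heart K D = f ` I"
    using nz D.idealD(2)[of "f ` I"] unfolding heart_def by blast
  then show ?thesis
    unfolding class_B_def subdirectly_irreducible_def
    using nz image_prod[OF I'(2) I'(2)] idem image_novikov_algebra[OF novikov] by simp
qed

end

text \<open>Operations act on representatives picked by \<open>SOME\<close>;
  \<open>quotient_simps\<close> shows that the choice is immaterial when \<open>M\<close> is an
  ideal. The result type is the one over which \<open>class_A\<close> quantifies.\<close>

definition quotient_algebra ::
    "('f, 'a, 'm) module_scheme \<Rightarrow> 'a set \<Rightarrow> ('f, 'a set) module" where
  "quotient_algebra A M = (let q = (\<lambda>x. M +>\<^bsub>A\<^esub> x); r = (\<lambda>u. SOME x. x \<in> u) in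
    \<lparr>carrier = q ` carrier A, mult = (\<lambda>u v. q (r u \<otimes>\<^bsub>A\<^esub> r v)), one = {},
      zero = q \<zero>\<^bsub>A\<^esub>, add = (\<lambda>u v. q (r u \<oplus>\<^bsub>A\<^esub> r v)), smult = (\<lambda>c u. q (c \<odot>\<^bsub>A\<^esub> r u))\<rparr>)"

context nonassoc_algebra
begin

lemma coset_mem: "y \<in> M +> x \<longleftrightarrow> (\<exists>m \<in> M. y = m \<oplus> x)"
  by (simp add: a_r_coset_def r_coset_def)

lemma coset_absorb:
  assumes M: "submodule K M A" and m: "m \<in> M" and x: "x \<in> carrier A"
  shows "M +> (m \<oplus> x) = M +> x"
proof (intro equalityI subsetI)
  have c: "k \<in> carrier A" if "k \<in> M" for k using M that by (auto simp: submodule_def)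
  have add: "k \<oplus> l \<in> M" if "k \<in> M" "l \<in> M" for k l using M that by (simp add: submodule_def)
  show "y \<in> M +> x" if "y \<in> M +> (m \<oplus> x)" for y
  proof -
    from that obtain k where k: "k \<in> M" "y = k \<oplus> (m \<oplus> x)" by (auto simp: coset_mem)
    then have "y = (k \<oplus> m) \<oplus> x" using m x c by (simp add: M.a_assoc)
    then show ?thesis unfolding coset_mem using add[OF k(1) m] by blast
  qed
  show "y \<in> M +> (m \<oplus> x)" if "y \<in> M +> x" for y
  proof -
    from that obtain k where k: "k \<in> M" "y = k \<oplus> x" by (auto simp: coset_mem)
    then have "y = (k \<oplus> \<ominus> m) \<oplus> (m \<oplus> x)" using m x c
      by (metis M.a_assoc M.a_inv_closed M.add.inv_solve_left M.add.m_closed M.r_neg1)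
    moreover have "k \<oplus> \<ominus> m \<in> M" using add k m submodule_minus[OF M] by blast
    ultimately show ?thesis unfolding coset_mem by blast
  qed
qed

lemma coset_self:
  assumes "submodule K M A" "x \<in> carrier A" shows "x \<in> M +> x"
  using assms by (auto simp: coset_mem submodule_def intro!: bexI[of _ \<zero>])

lemma coset_rep:
  assumes "submodule K M A" "x \<in> carrier A"
  obtains m where "m \<in> M" "(SOME y. y \<in> M +> x) = m \<oplus> x"
  using someI[of "\<lambda>y. y \<in> M +> x", OF coset_self[OF assms]] by (auto simp: coset_mem)

text \<open>The chosen representatives have the form \<open>m \<oplus> x\<close> with
  \<open>m\<close> in \<open>M\<close>. Each operation changes by an element of \<open>M\<close>
  when they replace \<open>x\<close> and \<open>y\<close>, and \<open>coset_absorb\<close> removes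
  it.\<close>

lemma quotient_simps:
  assumes M: "algebra_ideal K M A"
  shows "carrier (quotient_algebra A M) = (\<lambda>x. M +> x) ` carrier A"
    and "\<zero>\<^bsub>quotient_algebra A M\<^esub> = M +> \<zero>"
    and "\<And>x y. x \<in> carrier A \<Longrightarrow> y \<in> carrier A \<Longrightarrow>
      (M +> x) \<otimes>\<^bsub>quotient_algebra A M\<^esub> (M +> y) = M +> (x \<otimes> y)"
    and "\<And>x y. x \<in> carrier A \<Longrightarrow> y \<in> carrier A \<Longrightarrow>
      (M +> x) \<oplus>\<^bsub>quotient_algebra A M\<^esub> (M +> y) = M +> (x \<oplus> y)"
    and "\<And>c x. c \<in> carrier K \<Longrightarrow> x \<in> carrier A \<Longrightarrow>
      c \<odot>\<^bsub>quotient_algebra A M\<^esub> (M +> x) = M +> (c \<odot> x)"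
proof -
  note M' = idealD[OF M]
  have c: "m \<in> carrier A" if "m \<in> M" for m using that M'(2) by blast
  have cl: "\<And>m n. m \<in> M \<Longrightarrow> n \<in> M \<Longrightarrow> m \<oplus> n \<in> M"
    "\<And>a m. a \<in> carrier K \<Longrightarrow> m \<in> M \<Longrightarrow> a \<odot> m \<in> M" using M'(1) by (auto simp: submodule_def)
  show "carrier (quotient_algebra A M) = (\<lambda>x. M +> x) ` carrier A"
    "\<zero>\<^bsub>quotient_algebra A M\<^esub> = M +> \<zero>"
    by (simp_all add: quotient_algebra_def Let_def)
  fix x assume x: "x \<in> carrier A"
  obtain m where m: "m \<in> M" "(SOME z. z \<in> M +> x) = m \<oplus> x" using M'(1) x by (rule coset_rep)
  have "M +> (a \<odot> (m \<oplus> x)) = M +> (a \<odot> x)" if a: "a \<in> carrier K" for a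
    using coset_absorb[OF M'(1) cl(2)[OF a m(1)], of "a \<odot> x"] a x m(1) c
    by (simp add: smult_l_distr smult_r_distr)
  with m show "a \<odot>\<^bsub>quotient_algebra A M\<^esub> (M +> x) = M +> (a \<odot> x)" if "a \<in> carrier K" for a
    using that by (simp add: quotient_algebra_def Let_def)
  fix y assume y: "y \<in> carrier A"
  obtain n where n: "n \<in> M" "(SOME z. z \<in> M +> y) = n \<oplus> y" using M'(1) y by (rule coset_rep)
  have "(m \<oplus> x) \<oplus> (n \<oplus> y) = (m \<oplus> n) \<oplus> (x \<oplus> y)" using m(1) n(1) x y c by (simp add: M.a_ac)
  then show "(M +> x) \<oplus>\<^bsub>quotient_algebra A M\<^esub> (M +> y) = M +> (x \<oplus> y)"
    using coset_absorb[OF M'(1) cl(1)[OF m(1) n(1)], of "x \<oplus> y"] x y m(2) n(2)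
    by (simp add: quotient_algebra_def Let_def)
  \<comment> \<open>The bracketed error term lies in \<open>M\<close> because \<open>M\<close>
    absorbs products on both sides.\<close>
  have "(m \<oplus> x) \<otimes> (n \<oplus> y) = (m \<otimes> (n \<oplus> y) \<oplus> x \<otimes> n) \<oplus> x \<otimes> y"
    using m(1) n(1) x y c by (simp add: mult_add_left mult_add_right M.a_ac)
  moreover have "m \<otimes> (n \<oplus> y) \<oplus> x \<otimes> n \<in> M"
    using m(1) n(1) x y c by (intro cl(1) M'(3,4)) auto
  ultimately show "(M +> x) \<otimes>\<^bsub>quotient_algebra A M\<^esub> (M +> y) = M +> (x \<otimes> y)"
    using coset_absorb[OF M'(1), of "m \<otimes> (n \<oplus> y) \<oplus> x \<otimes> n" "x \<otimes> y"] x y m(2) n(2)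
    by (simp add: quotient_algebra_def Let_def)
qed

lemma quotient_nonassoc_algebra:
  assumes M: "algebra_ideal K M A" shows "nonassoc_algebra K (quotient_algebra A M)"
proof -
  let ?Q = "quotient_algebra A M"
  note Q = quotient_simps[OF M]
  have "module K ?Q"
  proof (rule module_criteria)
    show "cring K" by (rule cring_axioms)
    show "\<forall>v\<in>carrier ?Q. \<exists>w\<in>carrier ?Q. v \<oplus>\<^bsub>?Q\<^esub> w = \<zero>\<^bsub>?Q\<^esub>"
    proof
      fix v assume "v \<in> carrier ?Q"
      then obtain x where x: "v = M +> x" "x \<in> carrier A" by (auto simp: Q(1))
      then have "v \<oplus>\<^bsub>?Q\<^esub> (M +> (\<ominus> x)) = \<zero>\<^bsub>?Q\<^esub>" by (simp add: Q M.r_neg)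
      then show "\<exists>w\<in>carrier ?Q. v \<oplus>\<^bsub>?Q\<^esub> w = \<zero>\<^bsub>?Q\<^esub>" using x by (auto simp: Q(1))
    qed
    show "\<forall>v w. v \<in> carrier ?Q \<and> w \<in> carrier ?Q \<longrightarrow> v \<oplus>\<^bsub>?Q\<^esub> w = w \<oplus>\<^bsub>?Q\<^esub> v"
      by (auto simp: Q M.a_comm)
  qed (auto simp: Q M.a_assoc smult_l_distr smult_r_distr smult_assoc1)
  then have "vectorspace K ?Q" by (intro vectorspace.intro field_axioms)
  then show ?thesis
    by (intro nonassoc_algebra.intro nonassoc_algebra_axioms.intro)
      (auto simp: Q mult_add_left mult_add_right mult_smult_left mult_smult_right)
qed

lemma quotient_algebra_epi:
  assumes M: "algebra_ideal K M A"
  shows "algebra_epi K A (quotient_algebra A M) (\<lambda>x. M +> x)"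
  by (intro algebra_epi.intro algebra_epi_axioms.intro quotient_nonassoc_algebra M
      nonassoc_algebra_axioms)
    (auto simp: algebra_hom_def module_hom_def quotient_simps[OF M])

text \<open>Translates the conditions of \<open>class_B_image\<close>, stated through the kernel,
  into conditions on \<open>M\<close>.\<close>

lemma quotient_kernel:
  assumes M: "algebra_ideal K M A"
  shows "{x \<in> carrier A. M +> x = \<zero>\<^bsub>quotient_algebra A M\<^esub>} = M"
proof -
  note M' = idealD[OF M]
  have 0: "M +> \<zero> = M" using M'(2) by (force simp: coset_mem subset_iff)
  have "M +> x = M" if "x \<in> M" for x
    using coset_absorb[OF M'(1) that M.zero_closed] 0 that M'(2) by (simp add: subset_iff)
  moreover have "x \<in> M" if "x \<in> carrier A" "M +> x = M" for x
    using coset_self[OF M'(1) that(1)] that(2) by simp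
  ultimately show ?thesis using M'(2) by (auto simp: quotient_simps[OF M] 0)
qed

end

section \<open>The two radical classes\<close>

text \<open>Finite dimension enters twice: to stop the derived series at an idempotent ideal, and to
  choose \<open>M\<close>.\<close>

lemma (in novikov_algebra) class_A_imp_solvable:
  assumes fd: fin_dim and A: "class_A K A"
  shows "solvable_algebra K A"
proof (rule ccontr)
  assume not_solvable: "\<not> solvable_algebra K A"
  note D = derived_power_is_ideal
  have "derived_power K A (Suc n) \<subseteq> derived_power K A n" for n
    unfolding derived_power.simps using idealD[OF D[of n]]
    by (intro subspace_prod_least) (blast intro: subsetD)+
  then obtain n where n: "derived_power K A (Suc n) = derived_power K A n"
    using submodule_chain_stationary[OF fd, of "derived_power K A"] idealD(1)[OF D] by blast
  let ?D = "derived_power K A n"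
  define P where "P M \<longleftrightarrow> algebra_ideal K M A \<and> \<not> ?D \<subseteq> M" for M
  \<comment> \<open>Without solvability no derived power is zero, so the zero ideal does not contain
    \<open>?D\<close> and starts the choice of \<open>M\<close>.\<close>
  have "?D \<noteq> {\<zero>}" "\<zero> \<in> ?D"
    using not_solvable idealD(1)[OF D[of n]] by (auto simp: solvable_algebra_def submodule_def)
  then have "P {\<zero>}" using zero_ideal(1) by (auto simp: P_def)
  then obtain M where M: "P M" and max: "\<And>N. P N \<Longrightarrow> M \<subseteq> N \<Longrightarrow> N = M"
    using maximal_submodule_exists[OF fd, of P] idealD(1) unfolding P_def by metis
  have MI: "algebra_ideal K M A" using M by (simp add: P_def)
  interpret q: algebra_epi K A "quotient_algebra A M" "\<lambda>x. M +> x"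
    using MI by (rule quotient_algebra_epi)
  have "class_B K (quotient_algebra A M)"
  proof (rule q.class_B_image[OF novikov_algebra_axioms D])
    show "subspace_prod K A ?D ?D = ?D" using n by simp
    show "\<not> ?D \<subseteq> {x \<in> carrier A. M +> x = \<zero>\<^bsub>quotient_algebra A M\<^esub>}"
      using M by (simp add: quotient_kernel[OF MI] P_def)
    \<comment> \<open>Otherwise \<open>J\<close> would satisfy \<open>P\<close> and lie strictly
      above \<open>M\<close>, against maximality.\<close>
    show "?D \<subseteq> J" if "algebra_ideal K J A"
      "{x \<in> carrier A. M +> x = \<zero>\<^bsub>quotient_algebra A M\<^esub>} \<subset> J" for J
      using that max[of J] by (auto simp: quotient_kernel[OF MI] P_def)
  qed
  with A q.hom q.surj show False unfolding class_A_def by blast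
qed

lemma (in novikov_algebra) solvable_imp_class_A:
  assumes "solvable_algebra K A"
  shows "class_A K A"
  unfolding class_A_def
proof (intro conjI notI novikov_algebra_axioms)
  assume "\<exists>(C :: ('a, 'c set) module) h.
    class_B K C \<and> h \<in> algebra_hom K A C \<and> h ` carrier A = carrier C"
  then obtain C :: "('a, 'c set) module" and h
    where C: "class_B K C" "h \<in> algebra_hom K A C" "h ` carrier A = carrier C" by blast
  interpret C: novikov_algebra K C using C by (simp add: class_B_def)
  interpret h: algebra_epi K A C h using C by unfold_locales
  \<comment> \<open>The heart equals its own square, so containment in one derived power gives
    containment in the next.\<close>
  have H: "heart K C \<subseteq> derived_power K C n" for n
  proof (induction n)
    case 0 show ?case by (simp add: heart_def)
  next
    case (Suc n)
    then show ?case using C.subspace_prod_mono[OF Suc Suc] C(1) by (simp add: class_B_def)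
  qed
  obtain n where "derived_power K A n = {\<zero>}" using assms by (auto simp: solvable_algebra_def)
  then have "heart K C \<subseteq> {\<zero>\<^bsub>C\<^esub>}"
    using H[of n] h.H.f0_is_0 by (simp flip: h.image_derived_power)
  moreover have "\<zero>\<^bsub>C\<^esub> \<in> heart K C"
    using C.idealD(1) by (auto simp: heart_def submodule_def)
  ultimately show False using C(1) by (auto simp: class_B_def subdirectly_irreducible_def)
qed

theorem theorem3:
  fixes K :: "('f, 'k) ring_scheme" and A :: "('f, 'a, 'm) module_scheme"
  assumes "field K" and "\<one>\<^bsub>K\<^esub> \<oplus>\<^bsub>K\<^esub> \<one>\<^bsub>K\<^esub> \<noteq> \<zero>\<^bsub>K\<^esub>"
    and "novikov_algebra K A" and "vectorspace.fin_dim K A"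
  shows "baer_radical K A = andrunakievich_radical K A"
proof -
  interpret novikov_algebra K A by fact
  \<comment> \<open>Both radicals are \<open>Greatest\<close> of a predicate on sets, so agreement
    of the predicates suffices. An ideal is itself a finite dimensional Novikov algebra, so the two
    preceding lemmas apply to it.\<close>
  have "class_A K (A\<lparr>carrier := I\<rparr>) \<longleftrightarrow> solvable_algebra K (A\<lparr>carrier := I\<rparr>)"
    if I: "algebra_ideal K I A" for I
    using novikov_algebra.class_A_imp_solvable[OF ideal_novikov_algebra[OF I]]
      novikov_algebra.solvable_imp_class_A[OF ideal_novikov_algebra[OF I]]
      submodule_fin_dim[OF assms(4) idealD(1)[OF I]] by blast
  then show ?thesis unfolding baer_radical_def andrunakievich_radical_def
    by (intro arg_cong[where f = Greatest] ext) auto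
qed

end
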